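(* Let $(E,d)$ be a metric space with its Borel $\sigma$-field, let $p\ge1$, and let $\mu$ be a probability measure on $E$ such that for some $\varepsilon>0$ and some $x_0\in E$, $$\int_E e^{\varepsilon\,d^p(x,x_0)}\,\mu(dx)<+\infty .$$ Then there exists a constant $C(\varepsilon)$ such that for all probability measures $\nu$ on $E$ satisfying $H(\nu,\mu)\ge1$, $$W_p^p(\nu,\mu)\le C(\varepsilon)\,H(\nu,\mu).$$
   Context: $W_p(\nu,\mu)=\big(\inf_\pi\int_{E\times E}d^p(x,y)\,\pi(dx,dy)\big)^{1/p}$, where $\pi$ runs over all couplings of $(\nu,\mu)$, i.e. probability measures on $E\times E$ with marginals $\nu$ and $\mu$. $H(\nu,\mu)=\int\log\frac{d\nu}{d\mu}\,d\nu$ if $\nu\ll\mu$ and $H(\nu,\mu)=+\infty$ otherwise. The measure $\mu$ (and $p$) is fixed; the constant does not depend on $\nu$. *)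

theory Defs
  imports "HOL-Probability.Probability"
begin

text \<open>
  Couplings live on the Borel sigma-field of the product metric space, not on the product
  sigma-field \<open>borel \<Otimes>\<^sub>M borel\<close>. The two agree when \<open>'a\<close> is separable; in general only the former
  makes the distance function measurable.
\<close>

definition couplings ::
    "'a::metric_space measure \<Rightarrow> 'a measure \<Rightarrow> ('a \<times> 'a) measure set" where
  "couplings \<nu> \<mu> = {\<pi>. prob_space \<pi> \<and> sets \<pi> = sets borel \<and>
     distr \<pi> borel fst = \<nu> \<and> distr \<pi> borel snd = \<mu>}"

text \<open>Real powers on \<open>[0, \<infinity>]\<close>; only meaningful for exponents \<open>a > 0\<close>, where \<open>\<infinity>\<close> is sent to \<open>\<infinity>\<close>.\<close>

definition ennpowr :: "ennreal \<Rightarrow> real \<Rightarrow> ennreal" where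
  "ennpowr x a = (if x = \<infinity> then \<infinity> else ennreal (enn2real x powr a))"

definition wasserstein ::
    "real \<Rightarrow> 'a::metric_space measure \<Rightarrow> 'a measure \<Rightarrow> ennreal" where
  "wasserstein p \<nu> \<mu> =
     ennpowr (INF \<pi>\<in>couplings \<nu> \<mu>. \<integral>\<^sup>+ (x, y). ennreal (dist x y powr p) \<partial>\<pi>) (1 / p)"

text \<open>
  The extended-valued integral of \<open>log (d\<nu>/d\<mu>)\<close> against \<open>\<nu>\<close>, as positive part minus negative part:
  the library's \<open>KL_divergence\<close> is a Bochner integral, hence \<open>0\<close> when the true value is \<open>\<infinity>\<close>. For
  probability measures the negative part has integral at most \<open>exp (- 1)\<close>, so the difference is
  never of the form \<open>\<infinity> - \<infinity>\<close>. Base \<open>exp 1\<close> gives the natural logarithm. The arguments of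
  \<open>entropy_density\<close> and \<open>absolutely_continuous\<close> are in the opposite order to those of \<open>rel_entropy\<close>.
\<close>

definition rel_entropy :: "'a measure \<Rightarrow> 'a measure \<Rightarrow> ereal" where
  "rel_entropy \<nu> \<mu> =
     (if absolutely_continuous \<mu> \<nu>
      then enn2ereal (\<integral>\<^sup>+ x. ennreal (entropy_density (exp 1) \<mu> \<nu> x) \<partial>\<nu>)
           - enn2ereal (\<integral>\<^sup>+ x. ennreal (- entropy_density (exp 1) \<mu> \<nu> x) \<partial>\<nu>)
      else \<infinity>)"

end

theory Submission
  imports Defs
begin

text \<open>
  The independent coupling is already good enough. Since
  \<open>dist x y powr p \<le> 2 powr p * (dist x x\<^sub>0 powr p + dist y x\<^sub>0 powr p)\<close>, its cost is controlled by
  the \<open>p\<close>-th moments of \<open>\<nu>\<close> and \<open>\<mu>\<close> about \<open>x\<^sub>0\<close> (\<open>wasserstein_le_moments\<close>). Let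
  \<open>H = rel_entropy \<nu> \<mu>\<close>; for \<open>H = \<infinity>\<close> any \<open>C > 0\<close> will do, so let \<open>H\<close> be finite. With
  \<open>M = \<integral> exp (\<epsilon> * dist x x\<^sub>0 powr p) \<partial>\<mu>\<close>, the moment of \<open>\<mu>\<close> is at most \<open>M / \<epsilon>\<close> because \<open>t \<le> exp t\<close>,
  and the moment of \<open>\<nu>\<close> is at most \<open>(H + M) / \<epsilon>\<close> by the entropy inequality
  \<open>\<integral> g \<partial>\<nu> \<le> H + \<integral> exp g \<partial>\<mu>\<close> for \<open>g \<ge> 0\<close> (\<open>integral_le_rel_entropy\<close>). The assumption \<open>H \<ge> 1\<close> absorbs the
  additive constant into \<open>C * H\<close>, so \<open>C = 2 powr p / \<epsilon> * (1 + 2 * M)\<close> works.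

  One point needs care: couplings are measures on the Borel sets of \<open>'a \<times> 'a\<close>, which without
  separability need not be generated by measurable rectangles, so the product measure has too small
  a domain. The iterated integral \<open>\<integral> \<mu> {y. (x, y) \<in> A} \<partial>\<nu>\<close> still makes sense: for open \<open>A\<close> the
  integrand is lower semicontinuous in \<open>x\<close> (\<open>borel_measurable_emeasure_section_open\<close>), and open sets
  form an intersection-stable generator.
\<close>

section \<open>The independent coupling on a non-separable space\<close>

text \<open>
  If \<open>X n \<longlonglongrightarrow> x\<close>, every point of the section of an open \<open>A\<close> at \<open>x\<close> lies in the sections at all but
  finitely many \<open>X n\<close>. By continuity from below the measure of the section is therefore lower
  semicontinuous.
\<close>

lemma borel_measurable_emeasure_section_open:
  fixes A :: "('a::metric_space \<times> 'b::metric_space) set"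
  assumes sets_M: "sets M = sets borel" and A: "open A"
  shows "(\<lambda>x. emeasure M (Pair x -` A)) \<in> borel_measurable borel"
proof (rule borel_measurableI_le)
  have section_open: "open (Pair x -` A)" for x
    using A by (intro open_vimage continuous_intros)
  fix c :: ennreal
  have "closed {x. emeasure M (Pair x -` A) \<le> c}"
    unfolding closed_sequential_limits
  proof safe
    fix X x
    assume X: "\<forall>n. X n \<in> {x. emeasure M (Pair x -` A) \<le> c}" and lim: "X \<longlonglongrightarrow> x"
    define B where "B = (\<lambda>n. \<Inter>m\<in>{n..}. Pair (X m) -` A)"
    have B_sets: "B n \<in> sets M" for n
      unfolding B_def sets_M using section_open
      by (intro sets.countable_INT) auto
    have "incseq B"
      unfolding B_def by (intro incseq_SucI) auto
    have "Pair x -` A \<subseteq> (\<Union>n. B n)"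
    proof
      fix y assume y: "y \<in> Pair x -` A"
      have "(\<lambda>n. (X n, y)) \<longlonglongrightarrow> (x, y)"
        by (intro tendsto_intros lim)
      then have "\<forall>\<^sub>F n in sequentially. (X n, y) \<in> A"
        using A y by (auto dest: topological_tendstoD)
      then show "y \<in> (\<Union>n. B n)"
        by (auto simp: B_def eventually_sequentially)
    qed
    then have "emeasure M (Pair x -` A) \<le> emeasure M (\<Union>n. B n)"
      using B_sets by (intro emeasure_mono) auto
    also have "\<dots> = (SUP n. emeasure M (B n))"
      using B_sets \<open>incseq B\<close> by (intro SUP_emeasure_incseq[symmetric]) auto
    also have "\<dots> \<le> c"
    proof (rule SUP_least)
      fix n
      have "emeasure M (B n) \<le> emeasure M (Pair (X n) -` A)"
        using section_open[of "X n"] by (intro emeasure_mono) (auto simp: B_def sets_M)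
      also have "\<dots> \<le> c" using X by auto
      finally show "emeasure M (B n) \<le> c" .
    qed
    finally show "emeasure M (Pair x -` A) \<le> c" .
  qed
  then show "{x \<in> space borel. emeasure M (Pair x -` A) \<le> c} \<in> sets borel"
    by simp
qed

lemma measurable_Pair_borel:
  fixes x :: "'a::topological_space"
  assumes "sets M = sets (borel :: 'b::topological_space measure)"
  shows "Pair x \<in> measurable M borel"
  unfolding measurable_cong_sets[OF assms refl]
  by (intro borel_measurable_continuous_onI continuous_intros)

lemma measurable_section_kernel:
  fixes \<nu> :: "'a::metric_space measure" and \<mu> :: "'b::metric_space measure"
  assumes \<mu>: "prob_space \<mu>" "sets \<mu> = sets borel" and \<nu>: "sets \<nu> = sets borel"
  shows "(\<lambda>x. distr \<mu> borel (Pair x)) \<in> measurable \<nu> (subprob_algebra (borel :: ('a \<times> 'b) measure))"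
proof (rule measurable_subprob_algebra_generated[where G = "Collect open" and \<Omega> = UNIV])
  show "sets borel = sigma_sets (UNIV :: ('a \<times> 'b) set) (Collect open)"
    by (simp add: borel_def)
  show "Int_stable (Collect open :: ('a \<times> 'b) set set)"
    by (auto simp: Int_stable_def)
  have prob: "prob_space (distr \<mu> borel (Pair x))" for x :: 'a
    by (intro prob_space.prob_space_distr \<mu> measurable_Pair_borel)
  then show "subprob_space (distr \<mu> borel (Pair x))" for x :: 'a
    by (intro prob_space_imp_subprob_space)
  show "(\<lambda>x. emeasure (distr \<mu> borel (Pair x)) A) \<in> borel_measurable \<nu>"
    if "A \<in> Collect open" for A :: "('a \<times> 'b) set"
  proof -
    have "emeasure (distr \<mu> borel (Pair x)) A = emeasure \<mu> (Pair x -` A)" for x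
      using that measurable_Pair_borel[OF \<mu>(2), of x] sets_eq_imp_space_eq[OF \<mu>(2)]
      by (simp add: emeasure_distr)
    then show ?thesis
      using that borel_measurable_emeasure_section_open[OF \<mu>(2), of A]
      unfolding measurable_cong_sets[OF \<nu> refl] by simp
  qed
  show "(\<lambda>x. emeasure (distr \<mu> borel (Pair x)) (UNIV :: ('a \<times> 'b) set)) \<in> borel_measurable \<nu>"
    using prob_space.emeasure_space_1[OF prob] by simp
qed auto

definition indep_coupling ::
    "'a::metric_space measure \<Rightarrow> 'b::metric_space measure \<Rightarrow> ('a \<times> 'b) measure" where
  "indep_coupling \<nu> \<mu> = \<nu> \<bind> (\<lambda>x. distr \<mu> borel (Pair x))"

lemma indep_coupling_in_couplings:
  fixes \<nu> \<mu> :: "'a::metric_space measure"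
  assumes \<nu>: "prob_space \<nu>" "sets \<nu> = sets borel" and \<mu>: "prob_space \<mu>" "sets \<mu> = sets borel"
  shows "indep_coupling \<nu> \<mu> \<in> couplings \<nu> \<mu>"
proof -
  note kernel = measurable_section_kernel[OF \<mu> \<nu>(2)]
  note meas = measurable_Pair_borel[OF \<mu>(2)]
  have nonempty: "space \<nu> \<noteq> {}" by (rule prob_space.not_empty[OF \<nu>(1)])
  have fst: "fst \<in> measurable (borel :: ('a \<times> 'a) measure) borel"
    and snd: "snd \<in> measurable (borel :: ('a \<times> 'a) measure) borel"
    by (intro borel_measurable_continuous_onI continuous_intros)+
  have "prob_space (indep_coupling \<nu> \<mu>)"
    unfolding indep_coupling_def using meas
    by (intro prob_space.prob_space_bind[OF \<nu>(1) _ kernel])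
      (auto intro!: prob_space.prob_space_distr \<mu>)
  moreover have "sets (indep_coupling \<nu> \<mu>) = sets borel"
    unfolding indep_coupling_def using nonempty by (intro sets_bind) auto
  moreover have "distr (indep_coupling \<nu> \<mu>) borel fst = \<nu>"
  proof -
    have "distr (distr \<mu> borel (Pair x)) borel fst = return borel x" for x :: 'a
    proof -
      have "distr (distr \<mu> borel (Pair x)) borel fst = distr \<mu> borel (\<lambda>_. x)"
        by (subst distr_distr[OF fst meas]) (simp add: comp_def)
      then show ?thesis
        by (simp add: prob_space.distr_const[OF \<mu>(1)])
    qed
    then show ?thesis
      unfolding indep_coupling_def distr_bind[OF kernel nonempty fst]
      using bind_return''[OF \<nu>(2)] by simp
  qed
  moreover have "distr (indep_coupling \<nu> \<mu>) borel snd = \<mu>"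
  proof -
    have "distr (distr \<mu> borel (Pair x)) borel snd = \<mu>" for x :: 'a
      by (subst distr_distr[OF snd meas]) (simp add: comp_def distr_id2[OF \<mu>(2)[symmetric]])
    then show ?thesis
      unfolding indep_coupling_def distr_bind[OF kernel nonempty snd]
      using bind_const'[OF \<nu>(1) prob_space_imp_subprob_space[OF \<mu>(1)]] by simp
  qed
  ultimately show ?thesis
    unfolding couplings_def by simp
qed

lemma nn_integral_indep_coupling:
  fixes \<nu> :: "'a::metric_space measure" and \<mu> :: "'b::metric_space measure"
  assumes \<nu>: "sets \<nu> = sets borel" and \<mu>: "prob_space \<mu>" "sets \<mu> = sets borel"
    and f: "f \<in> borel_measurable borel"
  shows "(\<integral>\<^sup>+ z. f z \<partial>indep_coupling \<nu> \<mu>) = (\<integral>\<^sup>+ x. (\<integral>\<^sup>+ y. f (x, y) \<partial>\<mu>) \<partial>\<nu>)"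
  unfolding indep_coupling_def nn_integral_bind[OF f measurable_section_kernel[OF \<mu> \<nu>]]
  using f by (intro nn_integral_cong nn_integral_distr measurable_Pair_borel \<mu>) simp

section \<open>Transport cost and moments\<close>

lemma ennpowr_inverse: "p > 0 \<Longrightarrow> ennpowr (ennpowr x (1 / p)) p = x"
  by (cases x) (auto simp: ennpowr_def powr_powr)

lemma wasserstein_power_le:
  assumes "p > 0" and "\<pi> \<in> couplings \<nu> \<mu>"
  shows "ennpowr (wasserstein p \<nu> \<mu>) p \<le> (\<integral>\<^sup>+ (x, y). ennreal (dist x y powr p) \<partial>\<pi>)"
  unfolding wasserstein_def ennpowr_inverse[OF assms(1)] by (rule INF_lower[OF assms(2)])

lemma dist_powr_le:
  fixes x y z :: "'a::metric_space"
  assumes "p \<ge> 0"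
  shows "dist x y powr p \<le> 2 powr p * (dist x z powr p + dist y z powr p)"
proof -
  have "dist x y \<le> 2 * max (dist x z) (dist y z)"
    using dist_triangle2[of x y z] by linarith
  then have "dist x y powr p \<le> (2 * max (dist x z) (dist y z)) powr p"
    using assms by (intro powr_mono2) auto
  also have "\<dots> = 2 powr p * max (dist x z) (dist y z) powr p"
    by (simp add: powr_mult)
  also have "\<dots> \<le> 2 powr p * (dist x z powr p + dist y z powr p)"
    by (intro mult_left_mono) (auto simp: max_def)
  finally show ?thesis .
qed

lemma borel_measurable_dist_powr:
  fixes z :: "'a::metric_space"
  shows "(\<lambda>x. dist x z powr p) \<in> borel_measurable borel"
  by (intro powr_real_measurable borel_measurable_continuous_onI continuous_intros)

lemma wasserstein_le_moments:
  fixes \<nu> \<mu> :: "'a::metric_space measure"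
  assumes p: "p > 0"
    and \<nu>: "prob_space \<nu>" "sets \<nu> = sets borel" and \<mu>: "prob_space \<mu>" "sets \<mu> = sets borel"
  shows "ennpowr (wasserstein p \<nu> \<mu>) p \<le> ennreal (2 powr p) *
    ((\<integral>\<^sup>+ x. ennreal (dist x z powr p) \<partial>\<nu>) + (\<integral>\<^sup>+ y. ennreal (dist y z powr p) \<partial>\<mu>))"
proof -
  have meas: "(\<lambda>x::'a. ennreal (dist x z powr p)) \<in> borel_measurable borel"
    using borel_measurable_dist_powr by (rule measurable_compose[OF _ measurable_ennreal])
  note meas_\<nu> = meas[folded measurable_cong_sets[OF \<nu>(2) refl]]
    and meas_\<mu> = meas[folded measurable_cong_sets[OF \<mu>(2) refl]]
  have "continuous_on UNIV (\<lambda>z::'a \<times> 'a. dist (fst z) (snd z) powr p)"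
    using p by (intro continuous_on_powr' continuous_intros) auto
  then have cost: "(\<lambda>(x, y). ennreal (dist x y powr p)) \<in> borel_measurable (borel :: ('a \<times> 'a) measure)"
    unfolding split_beta by (intro measurable_compose[OF borel_measurable_continuous_onI measurable_ennreal])
  have "ennpowr (wasserstein p \<nu> \<mu>) p
      \<le> (\<integral>\<^sup>+ (x, y). ennreal (dist x y powr p) \<partial>indep_coupling \<nu> \<mu>)"
    by (intro wasserstein_power_le p indep_coupling_in_couplings \<nu> \<mu>)
  also have "\<dots> = (\<integral>\<^sup>+ x. (\<integral>\<^sup>+ y. ennreal (dist x y powr p) \<partial>\<mu>) \<partial>\<nu>)"
    by (simp add: nn_integral_indep_coupling[OF \<nu>(2) \<mu> cost])
  also have "\<dots> \<le> (\<integral>\<^sup>+ x. (\<integral>\<^sup>+ y. ennreal (2 powr p) *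
      (ennreal (dist x z powr p) + ennreal (dist y z powr p)) \<partial>\<mu>) \<partial>\<nu>)"
    using p dist_powr_le[of p _ _ z]
    by (intro nn_integral_mono)
      (simp add: ennreal_mult[symmetric] ennreal_plus[symmetric] ennreal_leI del: ennreal_plus)
  also have "\<dots> = (\<integral>\<^sup>+ x. ennreal (2 powr p) *
      (ennreal (dist x z powr p) + (\<integral>\<^sup>+ y. ennreal (dist y z powr p) \<partial>\<mu>)) \<partial>\<nu>)"
    using meas_\<mu>
    by (simp add: nn_integral_cmult nn_integral_add prob_space.emeasure_space_1[OF \<mu>(1)])
  also have "\<dots> = ennreal (2 powr p) *
      ((\<integral>\<^sup>+ x. ennreal (dist x z powr p) \<partial>\<nu>) + (\<integral>\<^sup>+ y. ennreal (dist y z powr p) \<partial>\<mu>))"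
    using meas_\<nu>
    by (simp add: nn_integral_cmult nn_integral_add prob_space.emeasure_space_1[OF \<nu>(1)])
  finally show ?thesis .
qed

section \<open>The entropy inequality\<close>

text \<open>
  Young's inequality for the conjugate pair \<open>t * ln t - t\<close> and \<open>exp\<close>, with the term \<open>- t\<close> dropped: for
  \<open>t > 0\<close> it is \<open>t * (g - ln t) \<le> t * exp (g - ln t) = exp g\<close>.
\<close>

lemma mult_le_entropy_plus_exp:
  fixes t g :: real
  assumes "t \<ge> 0"
  shows "t * g \<le> t * ln t + exp g"
proof (cases "t = 0")
  case False
  with assms have t: "t > 0" by simp
  have "t * (g - ln t) \<le> t * exp (g - ln t)"
    using t exp_ge_add_one_self[of "g - ln t"] by (intro mult_left_mono) linarith+
  also have "\<dots> = exp g"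
    using t by (simp add: exp_diff)
  finally show ?thesis
    by (simp add: algebra_simps)
qed simp

text \<open>
  This is \<open>mult_le_entropy_plus_exp\<close> with \<open>t = d\<nu>/d\<mu>\<close>, integrated against \<open>\<mu>\<close>. The negative part of
  the log-density stands on the left, so that all integrands are nonnegative and every term has a
  value in \<open>[0, \<infinity>]\<close>, whatever is integrable.
\<close>

lemma nn_integral_le_entropy_parts:
  fixes \<nu> \<mu> :: "'a measure" and g :: "'a \<Rightarrow> real"
  assumes \<nu>: "prob_space \<nu>" "sets \<nu> = sets \<mu>" and \<mu>: "prob_space \<mu>"
    and ac: "absolutely_continuous \<mu> \<nu>"
    and g: "g \<in> borel_measurable \<mu>" "\<And>x. g x \<ge> 0"
  shows "(\<integral>\<^sup>+ x. ennreal (g x) \<partial>\<nu>) + (\<integral>\<^sup>+ x. ennreal (- entropy_density (exp 1) \<mu> \<nu> x) \<partial>\<nu>)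
    \<le> (\<integral>\<^sup>+ x. ennreal (entropy_density (exp 1) \<mu> \<nu> x) \<partial>\<nu>) + (\<integral>\<^sup>+ x. ennreal (exp (g x)) \<partial>\<mu>)"
proof -
  interpret \<mu>: prob_space \<mu> by fact
  interpret \<nu>: prob_space \<nu> by fact
  define F where "F = RN_deriv \<mu> \<nu>"
  define l where "l = entropy_density (exp 1) \<mu> \<nu>"
  have F[measurable]: "F \<in> borel_measurable \<mu>"
    unfolding F_def by simp
  have l_eq: "l x = ln (enn2real (F x))" for x
    by (simp add: l_def F_def entropy_density_def log_def)
  have l[measurable]: "l \<in> borel_measurable \<mu>"
    unfolding l_eq[abs_def] by measurable
  note [measurable] = g(1)
  have change: "(\<integral>\<^sup>+ x. h x \<partial>\<nu>) = (\<integral>\<^sup>+ x. F x * h x \<partial>\<mu>)" if "h \<in> borel_measurable \<mu>" for h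
    unfolding F_def by (rule \<mu>.RN_deriv_nn_integral[OF ac \<nu>(2) that])
  have "(\<integral>\<^sup>+ x. ennreal (g x) \<partial>\<nu>) + (\<integral>\<^sup>+ x. ennreal (- l x) \<partial>\<nu>)
      = (\<integral>\<^sup>+ x. F x * ennreal (g x) + F x * ennreal (- l x) \<partial>\<mu>)"
    by (simp add: change nn_integral_add)
  also have "\<dots> \<le> (\<integral>\<^sup>+ x. F x * ennreal (l x) + ennreal (exp (g x)) \<partial>\<mu>)"
  proof (rule nn_integral_mono_AE)
    have "AE x in \<mu>. F x \<noteq> \<infinity>"
      unfolding F_def
      by (rule \<mu>.RN_deriv_finite[OF _ ac \<nu>(2)]) (rule \<nu>.sigma_finite_measure_axioms)
    then show "AE x in \<mu>. F x * ennreal (g x) + F x * ennreal (- l x)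
        \<le> F x * ennreal (l x) + ennreal (exp (g x))"
    proof eventually_elim
      case (elim x)
      then obtain t where t: "t \<ge> 0" "F x = ennreal t"
        by (cases "F x") auto
      have "t * g x \<le> t * l x + exp (g x)"
        using mult_le_entropy_plus_exp[OF t(1), of "g x"] t by (simp add: l_eq)
      moreover have "l x = max 0 (l x) - max 0 (- l x)"
        by auto
      ultimately have "t * g x + t * max 0 (- l x) \<le> t * max 0 (l x) + exp (g x)"
        by (metis add.commute add_le_cancel_right diff_add_cancel distrib_left add.assoc)
      moreover have "ennreal t * ennreal r = ennreal (t * max 0 r)" for r :: real
        using t(1) by (simp add: max_def ennreal_neg ennreal_mult)
      ultimately show ?case
        using t g(2)[of x]
        by (simp add: ennreal_plus[symmetric] ennreal_leI max_absorb2 del: ennreal_plus)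
    qed
  qed
  also have "\<dots> = (\<integral>\<^sup>+ x. ennreal (l x) \<partial>\<nu>) + (\<integral>\<^sup>+ x. ennreal (exp (g x)) \<partial>\<mu>)"
    by (simp add: change nn_integral_add)
  finally show ?thesis unfolding l_def .
qed

lemma integral_le_rel_entropy:
  fixes \<nu> \<mu> :: "'a measure" and g :: "'a \<Rightarrow> real"
  assumes \<nu>: "prob_space \<nu>" "sets \<nu> = sets \<mu>" and \<mu>: "prob_space \<mu>"
    and g: "g \<in> borel_measurable \<mu>" "\<And>x. g x \<ge> 0"
    and H: "rel_entropy \<nu> \<mu> = ereal h" "h \<ge> 0"
  shows "(\<integral>\<^sup>+ x. ennreal (g x) \<partial>\<nu>) \<le> ennreal h + (\<integral>\<^sup>+ x. ennreal (exp (g x)) \<partial>\<mu>)"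
proof -
  define P N where "P = (\<integral>\<^sup>+ x. ennreal (entropy_density (exp 1) \<mu> \<nu> x) \<partial>\<nu>)"
    and "N = (\<integral>\<^sup>+ x. ennreal (- entropy_density (exp 1) \<mu> \<nu> x) \<partial>\<nu>)"
  have ac: "absolutely_continuous \<mu> \<nu>"
    using H(1) by (auto simp: rel_entropy_def split: if_splits)
  then have diff: "enn2ereal P - enn2ereal N = ereal h"
    using H(1) by (simp add: rel_entropy_def P_def N_def)
  \<comment> \<open>A finite difference of two values in \<open>[0, \<infinity>]\<close> forces both to be finite, so \<open>N\<close> can be cancelled.\<close>
  then obtain a b where ab: "P = ennreal a" "a \<ge> 0" "N = ennreal b" "b \<ge> 0"
    by (cases P; cases N) (auto simp: enn2ereal_ennreal)
  with diff have "a = h + b" by (auto simp: enn2ereal_ennreal)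
  with ab H(2) have "P = ennreal h + N" by simp
  moreover have "(\<integral>\<^sup>+ x. ennreal (g x) \<partial>\<nu>) + N \<le> P + (\<integral>\<^sup>+ x. ennreal (exp (g x)) \<partial>\<mu>)"
    unfolding P_def N_def by (rule nn_integral_le_entropy_parts[OF \<nu> \<mu> ac g])
  ultimately have "N + (\<integral>\<^sup>+ x. ennreal (g x) \<partial>\<nu>)
      \<le> N + (ennreal h + (\<integral>\<^sup>+ x. ennreal (exp (g x)) \<partial>\<mu>))"
    by (simp add: ac_simps)
  then show ?thesis
    using ab by (simp add: ennreal_add_left_cancel_le)
qed

section \<open>The transport-entropy inequality\<close>

theorem lemma1p13:
  fixes \<mu> :: "'a::metric_space measure" and p \<epsilon> :: real and x\<^sub>0 :: 'a
  assumes "p \<ge> 1"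
    and "prob_space \<mu>" and "sets \<mu> = sets borel"
    and "\<epsilon> > 0"
    and "(\<integral>\<^sup>+ x. ennreal (exp (\<epsilon> * dist x x\<^sub>0 powr p)) \<partial>\<mu>) < \<infinity>"
  shows "\<exists>C::real. \<forall>\<nu>::'a measure.
           prob_space \<nu> \<and> sets \<nu> = sets borel \<and> rel_entropy \<nu> \<mu> \<ge> 1 \<longrightarrow>
           enn2ereal (ennpowr (wasserstein p \<nu> \<mu>) p) \<le> ereal C * rel_entropy \<nu> \<mu>"
proof -
  define g where "g = (\<lambda>x. \<epsilon> * dist x x\<^sub>0 powr p)"
  have g_nonneg: "g x \<ge> 0" for x
    using assms(4) by (simp add: g_def)
  have "g \<in> borel_measurable borel"
    unfolding g_def by (intro borel_measurable_times borel_measurable_const borel_measurable_dist_powr)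
  then have g: "g \<in> borel_measurable M" if "sets M = sets borel" for M
    by (simp add: measurable_cong_sets[OF that refl])
  obtain M where M: "M \<ge> 0" "(\<integral>\<^sup>+ x. ennreal (exp (g x)) \<partial>\<mu>) = ennreal M"
    using assms(5) by (cases "\<integral>\<^sup>+ x. ennreal (exp (g x)) \<partial>\<mu>") (auto simp: g_def)
  define C where "C = 2 powr p / \<epsilon> * (1 + 2 * M)"
  have "C > 0"
    unfolding C_def using assms(4) M(1) by simp
  show ?thesis
  proof (intro exI[of _ C] allI impI, elim conjE)
    fix \<nu> :: "'a measure"
    assume \<nu>: "prob_space \<nu>" "sets \<nu> = sets borel" and H: "rel_entropy \<nu> \<mu> \<ge> 1"
    show "enn2ereal (ennpowr (wasserstein p \<nu> \<mu>) p) \<le> ereal C * rel_entropy \<nu> \<mu>"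
    proof (cases "rel_entropy \<nu> \<mu>")
      case (real h)
      with H have h: "h \<ge> 1" by simp
      have moment: "(\<integral>\<^sup>+ x. ennreal (dist x x\<^sub>0 powr p) \<partial>m)
          = ennreal (1 / \<epsilon>) * (\<integral>\<^sup>+ x. ennreal (g x) \<partial>m)" if "sets m = sets borel" for m
        using assms(4) g[OF that]
        by (subst nn_integral_cmult[symmetric]) (auto simp: g_def ennreal_mult[symmetric])
      have moment_\<nu>: "(\<integral>\<^sup>+ x. ennreal (g x) \<partial>\<nu>) \<le> ennreal (h + M)"
        using integral_le_rel_entropy[OF \<nu>(1) _ assms(2) g[OF assms(3)] g_nonneg real] \<nu>(2) assms(3) h M
        by simp
      have "(\<integral>\<^sup>+ x. ennreal (g x) \<partial>\<mu>) \<le> (\<integral>\<^sup>+ x. ennreal (exp (g x)) \<partial>\<mu>)"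
        using exp_ge_add_one_self
        by (intro nn_integral_mono ennreal_leI) (smt (verit))
      then have moment_\<mu>: "(\<integral>\<^sup>+ x. ennreal (g x) \<partial>\<mu>) \<le> ennreal M"
        using M(2) by simp
      have "ennpowr (wasserstein p \<nu> \<mu>) p \<le> ennreal (2 powr p) *
          ((\<integral>\<^sup>+ x. ennreal (dist x x\<^sub>0 powr p) \<partial>\<nu>) + (\<integral>\<^sup>+ x. ennreal (dist x x\<^sub>0 powr p) \<partial>\<mu>))"
        using assms(1) by (intro wasserstein_le_moments \<nu> assms) simp
      also have "\<dots> \<le> ennreal (2 powr p) *
          (ennreal (1 / \<epsilon>) * ennreal (h + M) + ennreal (1 / \<epsilon>) * ennreal M)"
        unfolding moment[OF \<nu>(2)] moment[OF assms(3)]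
        by (intro mult_left_mono add_mono moment_\<nu> moment_\<mu>) auto
      also have "\<dots> = ennreal (2 powr p / \<epsilon> * (h + 2 * M))"
        using assms(4) h M(1)
        by (simp add: ennreal_mult[symmetric] ennreal_plus[symmetric] field_simps del: ennreal_plus)
      also have "\<dots> \<le> ennreal (C * h)"
      proof (rule ennreal_leI)
        have "h + 2 * M \<le> (1 + 2 * M) * h"
          using h M(1) mult_left_mono[of 1 h "2 * M"] by (simp add: algebra_simps)
        then have "2 powr p / \<epsilon> * (h + 2 * M) \<le> 2 powr p / \<epsilon> * ((1 + 2 * M) * h)"
          using assms(4) by (intro mult_left_mono) auto
        then show "2 powr p / \<epsilon> * (h + 2 * M) \<le> C * h"
          by (simp add: C_def mult.assoc)
      qed
      finally have "enn2ereal (ennpowr (wasserstein p \<nu> \<mu>) p) \<le> enn2ereal (ennreal (C * h))"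
        by (simp add: less_eq_ennreal.rep_eq)
      then show ?thesis
        using \<open>C > 0\<close> h real by (simp add: enn2ereal_ennreal)
    qed (use \<open>C > 0\<close> H in auto)
  qed
qed

end
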